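(* Let $0\le k<n$ and let $\begin{bmatrix}T(0)\\ P(0)\end{bmatrix}\in X_{n,k}$, where the $k\times k$ block $P(0)$ has the singular value decomposition $$P(0)=a\begin{bmatrix}I_{p\times p}&0&0\\ 0&\mathrm{diag}[c_i]_{q\times q}&0\\ 0&0&0_{r\times r}\end{bmatrix}b^*,$$ with $a,b\in\mathrm{Sp}(k)$, $p,q,r\ge 0$, $p+q+r=k$ and $0<c_i<1$ for $i=1,\dots,q$. For each $i$ let $C_i>0$ be such that $c_i^2=\frac{C_i}{1+C_i}$. Then the equation $P'=-2(PP^*-I_k)P$ with initial condition $P(0)$ has the solution $$P(t)=a\begin{bmatrix}I_{p\times p}&0&0\\ 0&\mathrm{diag}[c_i(t)]_{q\times q}&0\\ 0&0&0_{r\times r}\end{bmatrix}b^*,$$ where $c_i(t)>0$ is given by $$c_i(t)^2=\frac{C_ie^{4t}}{1+C_ie^{4t}}.$$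
   Context: $\mathrm{Sp}(k)$ is the group of $k\times k$ quaternionic matrices $A$ with $A^*A=I_k$. $X_{n,k}$ is the quaternionic Stiefel manifold of matrices $x\in\mathbb{H}^{n\times k}$ with $x^*x=I_k$, written in blocks $x=\begin{bmatrix}T\\ P\end{bmatrix}$ with $T\in\mathbb{H}^{(n-k)\times k}$, $P\in\mathbb{H}^{k\times k}$. The prime denotes the derivative with respect to the real variable $t$. The equation is the $P$-component of the gradient flow equation $\alpha'(t)=\mathrm{grad}\, h_{\alpha(t)}$, $\alpha=\begin{bmatrix}T\\ P\end{bmatrix}$, of the function $h(x)=\mathrm{Tr}(P^*P)$ on $X_{n,k}$, which reads $T'=-2TP^*P$, $P'=-2(PP^*-I_k)P$. *)

theory Defs
  imports "HOL-Analysis.Inner_Product" "Jordan_Normal_Form.Matrix"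
begin

section \<open>Quaternions\<close>

datatype quat = Quat (q_re: real) (q_i: real) (q_j: real) (q_k: real)

lemma quat_eq_iff:
  "x = y \<longleftrightarrow> q_re x = q_re y \<and> q_i x = q_i y \<and> q_j x = q_j y \<and> q_k x = q_k y"
  by (cases x; cases y) simp

instantiation quat :: ring_1
begin

definition zero_quat :: quat where "0 = Quat 0 0 0 0"
definition one_quat :: quat where "1 = Quat 1 0 0 0"
definition plus_quat :: "quat \<Rightarrow> quat \<Rightarrow> quat" where
  "x + y = Quat (q_re x + q_re y) (q_i x + q_i y) (q_j x + q_j y) (q_k x + q_k y)"
definition uminus_quat :: "quat \<Rightarrow> quat" where
  "- x = Quat (- q_re x) (- q_i x) (- q_j x) (- q_k x)"
definition minus_quat :: "quat \<Rightarrow> quat \<Rightarrow> quat" where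
  "x - y = Quat (q_re x - q_re y) (q_i x - q_i y) (q_j x - q_j y) (q_k x - q_k y)"
definition times_quat :: "quat \<Rightarrow> quat \<Rightarrow> quat" where
  "x * y = Quat
     (q_re x * q_re y - q_i x * q_i y - q_j x * q_j y - q_k x * q_k y)
     (q_re x * q_i y + q_i x * q_re y + q_j x * q_k y - q_k x * q_j y)
     (q_re x * q_j y - q_i x * q_k y + q_j x * q_re y + q_k x * q_i y)
     (q_re x * q_k y + q_i x * q_j y - q_j x * q_i y + q_k x * q_re y)"

lemmas quat_arith_defs =
  zero_quat_def one_quat_def plus_quat_def uminus_quat_def minus_quat_def times_quat_def

instance
  by standard (simp_all add: quat_arith_defs quat_eq_iff algebra_simps)

end

instantiation quat :: real_algebra_1
begin

definition scaleR_quat :: "real \<Rightarrow> quat \<Rightarrow> quat" where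
  "r *\<^sub>R x = Quat (r * q_re x) (r * q_i x) (r * q_j x) (r * q_k x)"

instance
  by standard (simp_all add: quat_arith_defs scaleR_quat_def quat_eq_iff algebra_simps)

end

instantiation quat :: real_inner
begin

definition inner_quat :: "quat \<Rightarrow> quat \<Rightarrow> real" where
  "inner x y = q_re x * q_re y + q_i x * q_i y + q_j x * q_j y + q_k x * q_k y"
definition norm_quat :: "quat \<Rightarrow> real" where
  "norm x = sqrt ((q_re x)\<^sup>2 + (q_i x)\<^sup>2 + (q_j x)\<^sup>2 + (q_k x)\<^sup>2)"
definition sgn_quat :: "quat \<Rightarrow> quat" where
  "sgn (x :: quat) = x /\<^sub>R norm x"
definition dist_quat :: "quat \<Rightarrow> quat \<Rightarrow> real" where
  "dist (x :: quat) y = norm (x - y)"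
definition uniformity_quat :: "(quat \<times> quat) filter" where
  "uniformity = (INF e\<in>{0 <..}. principal {(x :: quat, y). dist x y < e})"
definition open_quat :: "quat set \<Rightarrow> bool" where
  "open (U :: quat set) \<longleftrightarrow> (\<forall>x\<in>U. eventually (\<lambda>(x', y). x' = x \<longrightarrow> y \<in> U) uniformity)"

instance
proof
  fix x y z :: quat and r :: real and U :: "quat set"
  show "dist x y = norm (x - y)" by (rule dist_quat_def)
  show "sgn x = x /\<^sub>R norm x" by (rule sgn_quat_def)
  show "(uniformity :: (quat \<times> quat) filter) = (INF e\<in>{0 <..}. principal {(x :: quat, y). dist x y < e})"
    by (rule uniformity_quat_def)
  show "open U \<longleftrightarrow> (\<forall>x\<in>U. eventually (\<lambda>(x', y). x' = x \<longrightarrow> y \<in> U) uniformity)"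
    by (rule open_quat_def)
  show "inner x y = inner y x" by (simp add: inner_quat_def mult.commute)
  show "inner (x + y) z = inner x z + inner y z"
    by (simp add: inner_quat_def plus_quat_def algebra_simps)
  show "inner (r *\<^sub>R x) y = r * inner x y"
    by (simp add: inner_quat_def scaleR_quat_def algebra_simps)
  show "0 \<le> inner x x" by (simp add: inner_quat_def)
  show "inner x x = 0 \<longleftrightarrow> x = 0"
    by (simp add: inner_quat_def zero_quat_def quat_eq_iff add_nonneg_eq_0_iff conj_assoc)
  show "norm x = sqrt (inner x x)"
    by (simp add: norm_quat_def inner_quat_def power2_eq_square)
qed

end

instance quat :: real_normed_algebra_1
proof
  fix x y :: quat
  have "norm (x * y) = norm x * norm y"
    unfolding norm_quat_def real_sqrt_mult[symmetric]
    by (simp add: times_quat_def power2_eq_square algebra_simps)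
  then show "norm (x * y) \<le> norm x * norm y" by simp
  show "norm (1 :: quat) = 1" by (simp add: norm_quat_def one_quat_def)
qed

definition qcnj :: "quat \<Rightarrow> quat" where
  "qcnj x = Quat (q_re x) (- q_i x) (- q_j x) (- q_k x)"


section \<open>Quaternionic matrices\<close>

text \<open>The adjoint in theory \<open>Jordan_Normal_Form.Schur_Decomposition\<close> is unavailable here: it is
  restricted to (commutative) fields with a multiplicative conjugation, whereas the conjugation of
  quaternions reverses products.\<close>

definition mat_adj :: "quat mat \<Rightarrow> quat mat" where
  "mat_adj A = mat (dim_col A) (dim_row A) (\<lambda>(i, j). qcnj (A $$ (j, i)))"

definition Sp :: "nat \<Rightarrow> quat mat set" where
  "Sp k = {A \<in> carrier_mat k k. mat_adj A * A = 1\<^sub>m k}"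

definition stiefel :: "nat \<Rightarrow> nat \<Rightarrow> quat mat set" where
  "stiefel n k = {x \<in> carrier_mat n k. mat_adj x * x = 1\<^sub>m k}"

definition sv_mat :: "nat \<Rightarrow> nat \<Rightarrow> nat \<Rightarrow> (nat \<Rightarrow> real) \<Rightarrow> quat mat" where
  "sv_mat p q r c = diag_block_mat [1\<^sub>m p, mat_diag q (\<lambda>i. of_real (c i)), 0\<^sub>m r r]"


section \<open>The differential equation\<close>

definition has_mat_derivative ::
  "(real \<Rightarrow> quat mat) \<Rightarrow> quat mat \<Rightarrow> nat \<Rightarrow> nat \<Rightarrow> real \<Rightarrow> bool" where
  "has_mat_derivative X D m n t \<longleftrightarrow>
     D \<in> carrier_mat m n \<and>
     (\<forall>i<m. \<forall>j<n. ((\<lambda>s. X s $$ (i, j)) has_vector_derivative D $$ (i, j)) (at t))"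

text \<open>Derivatives are two-sided, so \<open>J\<close> is meant to be an open interval containing 0; the values of
  \<open>P\<close> outside \<open>J\<close> are irrelevant.\<close>

definition flow_solution ::
  "nat \<Rightarrow> quat mat \<Rightarrow> real set \<Rightarrow> (real \<Rightarrow> quat mat) \<Rightarrow> bool" where
  "flow_solution k P0 J P \<longleftrightarrow>
     P 0 = P0 \<and>
     (\<forall>t\<in>J. P t \<in> carrier_mat k k \<and>
        has_mat_derivative P ((- 2) \<cdot>\<^sub>m ((P t * mat_adj (P t) - 1\<^sub>m k) * P t)) k k t)"

end

theory Submission
  imports Defs "HOL-Analysis.Convex"
begin

text \<open>
  Up to the constant factor \<open>-2\<close>, the equation is driven by the cubic field
  \<open>X \<mapsto> X X\<^sup>* X - X\<close>. Two properties of this field give the result.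

  The field commutes with \<open>X \<mapsto> a X b\<^sup>*\<close> for \<open>a, b \<in> Sp k\<close>, because the inner factors
  \<open>b\<^sup>* b\<close> and \<open>a\<^sup>* a\<close> cancel in \<open>X X\<^sup>* X\<close> (\<open>cubic_field_equivariant\<close>). It also preserves
  real diagonal matrices, on which it acts entry by entry. Conjugating by the singular vectors
  therefore decouples the matrix equation into the scalar equations \<open>s' = 2 (s - s\<^sup>3)\<close>, one for
  each singular value. The values \<open>0\<close> and \<open>1\<close> are equilibria. In between, \<open>s\<^sup>2\<close> obeys the
  logistic equation \<open>(s\<^sup>2)' = 4 s\<^sup>2 (1 - s\<^sup>2)\<close>, whose solutions are the functions
  \<open>C e\<^sup>4\<^sup>t / (1 + C e\<^sup>4\<^sup>t)\<close>. This gives \<open>flow_solution_svd\<close>.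

  The field is polynomial, hence locally Lipschitz (\<open>cubic_field_lipschitz\<close>). For two solutions on
  a common interval around \<open>0\<close>, the squared Euclidean distance \<open>E\<close> thus satisfies
  \<open>\<bar>E'\<bar> \<le> M E\<close> with a continuous \<open>M\<close> and \<open>E 0 = 0\<close>, and Gronwall's argument forces \<open>E = 0\<close>
  (\<open>flow_solution_unique\<close>). Distances are measured in the entrywise \<open>l\<^sup>1\<close> norm for the Lipschitz
  estimate, since that norm is submultiplicative by a direct computation, and in the Euclidean norm
  for Gronwall's argument, since its square is differentiable everywhere.
\<close>

section \<open>Gronwall's argument for vanishing functions\<close>

text \<open>On the compact interval \<open>M\<close> has an upper bound \<open>K\<close>, so \<open>E s exp (- K s)\<close> is nonincreasing.
  It starts at \<open>0\<close> and is nonnegative.\<close>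

lemma gronwall_zero_forward:
  fixes E E' M :: "real \<Rightarrow> real"
  assumes t: "0 \<le> t"
    and deriv: "\<And>s. 0 \<le> s \<Longrightarrow> s \<le> t \<Longrightarrow> (E has_real_derivative E' s) (at s)"
    and bound: "\<And>s. 0 \<le> s \<Longrightarrow> s \<le> t \<Longrightarrow> E' s \<le> M s * E s"
    and cont: "\<And>s. 0 \<le> s \<Longrightarrow> s \<le> t \<Longrightarrow> isCont M s"
    and nonneg: "\<And>s. 0 \<le> E s" and init: "E 0 = 0"
  shows "E t = 0"
proof -
  obtain K where K: "\<And>s. 0 \<le> s \<Longrightarrow> s \<le> t \<Longrightarrow> M s \<le> K"
    using isCont_bounded[of 0 t M] t cont by blast
  have "E t * exp (- K * t) \<le> E 0 * exp (- K * 0)"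
  proof (rule DERIV_nonpos_imp_nonincreasing[OF t])
    fix s assume s: "0 \<le> s" "s \<le> t"
    have "((\<lambda>s. E s * exp (- K * s)) has_real_derivative
        (E' s - K * E s) * exp (- K * s)) (at s)"
      by (auto intro!: derivative_eq_intros deriv[OF s] simp: algebra_simps)
    moreover have "E' s \<le> K * E s"
      using bound[OF s] mult_right_mono[OF K[OF s] nonneg[of s]] by linarith
    then have "(E' s - K * E s) * exp (- K * s) \<le> 0"
      by (intro mult_nonpos_nonneg) auto
    ultimately show "\<exists>y. ((\<lambda>s. E s * exp (- K * s)) has_real_derivative y) (at s) \<and> y \<le> 0"
      by blast
  qed
  with init have "E t \<le> 0"
    by (simp add: mult_le_0_iff)
  with nonneg[of t] show ?thesis by simp
qed

text \<open>For negative times the forward statement applies to \<open>s \<mapsto> E (- s)\<close>; this is why the bound is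
  on \<open>\<bar>E'\<bar>\<close> rather than on \<open>E'\<close>.\<close>

lemma gronwall_zero:
  fixes E E' M :: "real \<Rightarrow> real"
  assumes J: "connected J" "0 \<in> J" and t: "t \<in> J"
    and deriv: "\<And>s. s \<in> J \<Longrightarrow> (E has_real_derivative E' s) (at s)"
    and bound: "\<And>s. s \<in> J \<Longrightarrow> \<bar>E' s\<bar> \<le> M s * E s"
    and cont: "\<And>s. s \<in> J \<Longrightarrow> isCont M s"
    and nonneg: "\<And>s. 0 \<le> E s" and init: "E 0 = 0"
  shows "E t = 0"
proof (cases "0 \<le> t")
  case True
  have J': "s \<in> J" if "0 \<le> s" "s \<le> t" for s
    using connected_contains_Icc[OF J(1) J(2) t] that by auto
  show ?thesis
    by (rule gronwall_zero_forward[of t E E' M])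
      (use True J' deriv bound cont nonneg init in \<open>auto intro: abs_le_D1\<close>)
next
  case False
  have J': "- s \<in> J" if "0 \<le> s" "s \<le> - t" for s
    using connected_contains_Icc[OF J(1) t J(2)] that by auto
  have "E (- (- t)) = 0"
  proof (rule gronwall_zero_forward[of "- t" "\<lambda>s. E (- s)" "\<lambda>s. - E' (- s)" "\<lambda>s. M (- s)"])
    fix s assume s: "0 \<le> s" "s \<le> - t"
    show "((\<lambda>s. E (- s)) has_real_derivative - E' (- s)) (at s)"
      using DERIV_chain2[where f = E and g = uminus and x = s and Db = "- 1", OF deriv[OF J'[OF s]]]
      by (simp add: DERIV_minus[OF DERIV_ident])
    show "- E' (- s) \<le> M (- s) * E (- s)"
      using bound[OF J'[OF s]] by linarith
    show "isCont (\<lambda>s. M (- s)) s"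
      by (rule continuous_within_compose3[where g = M and f = uminus and x = s, OF cont[OF J'[OF s]]]) (auto intro: continuous_intros)
  qed (use False nonneg init in auto)
  then show ?thesis by simp
qed


section \<open>Adjoints and the cubic field\<close>

lemma dim_mat_adj [simp]:
  "dim_row (mat_adj A) = dim_col A" "dim_col (mat_adj A) = dim_row A"
  by (simp_all add: mat_adj_def)

lemma mat_adj_carrier [simp, intro]: "A \<in> carrier_mat m n \<Longrightarrow> mat_adj A \<in> carrier_mat n m"
  by auto

text \<open>The square case as a rewrite rule: its premises leave no inner dimension to be guessed.\<close>

lemma mult_square_carrier_mat [simp]:
  "A \<in> carrier_mat k k \<Longrightarrow> B \<in> carrier_mat k k \<Longrightarrow> A * B \<in> carrier_mat k k"
  by simp

lemma index_mat_adj [simp]: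
  "i < dim_col A \<Longrightarrow> j < dim_row A \<Longrightarrow> mat_adj A $$ (i, j) = qcnj (A $$ (j, i))"
  by (simp add: mat_adj_def)

text \<open>Entrywise estimates and derivatives of matrix products are taken term by term in this sum.\<close>

lemma index_mult_mat_sum:
  assumes "A \<in> carrier_mat m l" "B \<in> carrier_mat l n" "i < m" "j < n"
  shows "(A * B) $$ (i, j) = (\<Sum>h<l. A $$ (i, h) * B $$ (h, j))"
  using assms by (auto simp: scalar_prod_def atLeast0LessThan intro!: sum.cong)

lemma qcnj_simps [simp]:
  "qcnj (qcnj x) = x" "qcnj 0 = 0" "qcnj (x + y) = qcnj x + qcnj y"
  "qcnj (x - y) = qcnj x - qcnj y" "qcnj (x * y) = qcnj y * qcnj x"
  by (simp_all add: qcnj_def quat_arith_defs)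

lemma qcnj_of_real [simp]: "qcnj (of_real r) = of_real r"
  by (simp add: of_real_def qcnj_def scaleR_quat_def one_quat_def)

lemma norm_qcnj [simp]: "norm (qcnj x) = norm x"
  by (simp add: qcnj_def norm_quat_def)

lemma qcnj_sum: "qcnj (sum f A) = (\<Sum>x\<in>A. qcnj (f x))"
  by (induction A rule: infinite_finite_induct) simp_all

lemma mat_adj_mult:
  assumes "A \<in> carrier_mat m l" "B \<in> carrier_mat l n"
  shows "mat_adj (A * B) = mat_adj B * mat_adj A"
proof (rule eq_matI)
  fix i j assume "i < dim_row (mat_adj B * mat_adj A)" "j < dim_col (mat_adj B * mat_adj A)"
  with assms have ij: "i < n" "j < m" by auto
  with assms show "mat_adj (A * B) $$ (i, j) = (mat_adj B * mat_adj A) $$ (i, j)"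
    by (simp add: index_mult_mat_sum[of _ n l _ m] index_mult_mat_sum[OF assms]
        qcnj_sum del: index_mult_mat(1))
qed (use assms in auto)

lemma mat_adj_adj: "mat_adj (mat_adj A) = A"
  by (rule eq_matI) auto

lemma mat_adj_minus:
  assumes "A \<in> carrier_mat m n" "B \<in> carrier_mat m n"
  shows "mat_adj (A - B) = mat_adj A - mat_adj B"
  by (rule eq_matI) (use assms in auto)

definition cubic_field :: "quat mat \<Rightarrow> quat mat" where
  "cubic_field X = X * mat_adj X * X - X"

lemma cubic_field_carrier [simp, intro]: "X \<in> carrier_mat k k \<Longrightarrow> cubic_field X \<in> carrier_mat k k"
  by (auto simp: cubic_field_def)

lemma flow_rhs_eq_cubic_field:
  assumes "X \<in> carrier_mat k k"
  shows "(- 2) \<cdot>\<^sub>m ((X * mat_adj X - 1\<^sub>m k) * X) = of_real (- 2) \<cdot>\<^sub>m cubic_field X"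
proof -
  have "(X * mat_adj X - 1\<^sub>m k) * X = cubic_field X"
    using assms minus_mult_distrib_mat[of "X * mat_adj X" k k "1\<^sub>m k" X k]
    by (simp add: cubic_field_def)
  then show ?thesis by simp
qed

text \<open>Telescoping \<open>X X\<^sup>* X - Y Y\<^sup>* Y\<close> one factor at a time makes \<open>X - Y\<close> or its adjoint a factor of
  every term, as a Lipschitz estimate needs.\<close>

lemma cubic_field_diff:
  assumes X: "X \<in> carrier_mat k k" and Y: "Y \<in> carrier_mat k k"
  shows "cubic_field X - cubic_field Y =
    (X - Y) * (mat_adj X * X) + (Y * mat_adj (X - Y)) * X + (Y * mat_adj Y) * (X - Y) - (X - Y)"
proof -
  have [simp]: "mat_adj X \<in> carrier_mat k k" "mat_adj Y \<in> carrier_mat k k" using X Y by auto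
  have 1: "(X - Y) * (mat_adj X * X) = X * mat_adj X * X - Y * mat_adj X * X"
    using X Y by (simp add: minus_mult_distrib_mat[of _ k k _ _ k] del: assoc_mult_mat)
      (simp add: assoc_mult_mat[of _ k k _ k _ k])
  have 2: "(Y * mat_adj (X - Y)) * X = Y * mat_adj X * X - Y * mat_adj Y * X"
    using X Y by (simp add: mat_adj_minus[OF X Y] mult_minus_distrib_mat[of _ k k _ k]
        minus_mult_distrib_mat[of _ k k _ _ k] del: assoc_mult_mat)
  have 3: "(Y * mat_adj Y) * (X - Y) = Y * mat_adj Y * X - Y * mat_adj Y * Y"
    using X Y by (simp add: mult_minus_distrib_mat[of _ k k _ k] del: assoc_mult_mat)
  show ?thesis
    unfolding 1 2 3 cubic_field_def
    by (rule eq_matI) (use X Y in \<open>auto simp del: assoc_mult_mat index_mult_mat(1)\<close>)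
qed

section \<open>A submultiplicative norm and the Lipschitz estimate\<close>

definition entry_norm :: "nat \<Rightarrow> quat mat \<Rightarrow> real" where
  "entry_norm k A = (\<Sum>i<k. \<Sum>j<k. norm (A $$ (i, j)))"

lemma entry_norm_nonneg [simp]: "0 \<le> entry_norm k A"
  by (simp add: entry_norm_def sum_nonneg)

lemma norm_index_le_entry_norm:
  assumes "i < k" "j < k"
  shows "norm (A $$ (i, j)) \<le> entry_norm k A"
proof -
  have "norm (A $$ (i, j)) \<le> (\<Sum>j<k. norm (A $$ (i, j)))"
    using assms by (intro member_le_sum) auto
  also have "\<dots> \<le> entry_norm k A"
    unfolding entry_norm_def using assms
    by (intro member_le_sum[of i _ "\<lambda>i. \<Sum>j<k. norm (A $$ (i, j))"]) (auto intro: sum_nonneg)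
  finally show ?thesis .
qed

lemma entry_norm_adj:
  assumes "A \<in> carrier_mat k k"
  shows "entry_norm k (mat_adj A) = entry_norm k A"
  unfolding entry_norm_def using assms by (subst sum.swap) simp

lemma entry_norm_add:
  assumes "A \<in> carrier_mat k k" "B \<in> carrier_mat k k"
  shows "entry_norm k (A + B) \<le> entry_norm k A + entry_norm k B"
  unfolding entry_norm_def sum.distrib[symmetric] using assms
  by (auto intro!: sum_mono norm_triangle_ineq)

lemma entry_norm_diff:
  assumes "A \<in> carrier_mat k k" "B \<in> carrier_mat k k"
  shows "entry_norm k (A - B) \<le> entry_norm k A + entry_norm k B"
  unfolding entry_norm_def sum.distrib[symmetric] using assms
  by (auto intro!: sum_mono norm_triangle_ineq4)

lemma entry_norm_mult:
  assumes "A \<in> carrier_mat k k" "B \<in> carrier_mat k k"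
  shows "entry_norm k (A * B) \<le> entry_norm k A * entry_norm k B"
proof -
  have "entry_norm k (A * B) \<le>
      (\<Sum>i<k. \<Sum>j<k. \<Sum>h<k. norm (A $$ (i, h)) * norm (B $$ (h, j)))"
    unfolding entry_norm_def using assms
    by (auto simp: index_mult_mat_sum[of A k k B k] simp del: index_mult_mat(1)
        intro!: sum_mono order_trans[OF norm_sum] norm_mult_ineq)
  also have "\<dots> = (\<Sum>i<k. \<Sum>h<k. norm (A $$ (i, h)) * (\<Sum>j<k. norm (B $$ (h, j))))"
    unfolding sum_distrib_left by (rule sum.cong[OF refl], rule sum.swap)
  also have "\<dots> \<le> (\<Sum>i<k. \<Sum>h<k. norm (A $$ (i, h)) * entry_norm k B)"
    unfolding entry_norm_def
    by (intro sum_mono mult_left_mono member_le_sum[of _ _ "\<lambda>h. \<Sum>j<k. norm (B $$ (h, j))"])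
      (auto intro: sum_nonneg)
  also have "\<dots> = entry_norm k A * entry_norm k B"
    by (simp add: entry_norm_def sum_distrib_right)
  finally show ?thesis .
qed

text \<open>The Cauchy-Schwarz comparison that turns a bound in the entrywise \<open>l\<^sup>1\<close> norm into one in the
  Euclidean norm; \<open>k\<^sup>2\<close> is the number of entries.\<close>

lemma entry_norm_squared_le:
  "(entry_norm k A)\<^sup>2 \<le> (real k)\<^sup>2 * (\<Sum>i<k. \<Sum>j<k. (norm (A $$ (i, j)))\<^sup>2)"
proof -
  have "(entry_norm k A)\<^sup>2 = (\<Sum>(i, j)\<in>{..<k} \<times> {..<k}. norm (A $$ (i, j)))\<^sup>2"
    by (simp add: entry_norm_def sum.cartesian_product)
  also have "\<dots> \<le> (\<Sum>x\<in>{..<k} \<times> {..<k}. (case x of (i, j) \<Rightarrow> norm (A $$ (i, j)))\<^sup>2) * card ({..<k} \<times> {..<k})"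
    by (rule sum_squared_le_sum_of_squares)
  also have "\<dots> = (real k)\<^sup>2 * (\<Sum>i<k. \<Sum>j<k. (norm (A $$ (i, j)))\<^sup>2)"
    by (simp add: sum.cartesian_product power2_eq_square case_prod_unfold)
  finally show ?thesis .
qed

text \<open>The Lipschitz factor depends on \<open>X\<close> and \<open>Y\<close> only through their norms, hence is continuous in
  time along two solutions.\<close>

lemma cubic_field_lipschitz:
  assumes X: "X \<in> carrier_mat k k" and Y: "Y \<in> carrier_mat k k"
  shows "entry_norm k (cubic_field X - cubic_field Y) \<le>
    ((entry_norm k X)\<^sup>2 + entry_norm k X * entry_norm k Y + (entry_norm k Y)\<^sup>2 + 1) * entry_norm k (X - Y)"
proof -
  define D where "D = X - Y"
  have [simp]: "D \<in> carrier_mat k k" "mat_adj D \<in> carrier_mat k k"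
    "mat_adj X \<in> carrier_mat k k" "mat_adj Y \<in> carrier_mat k k"
    using X Y by (auto simp: D_def)
  note [simp] = X Y entry_norm_adj
  have le2: "entry_norm k (A * B) \<le> u * v"
    if "entry_norm k A \<le> u" "entry_norm k B \<le> v" "A \<in> carrier_mat k k" "B \<in> carrier_mat k k"
    for A B u v
    using entry_norm_mult[OF that(3,4)] mult_mono'[OF that(1,2)] by simp
  have 1: "entry_norm k (D * (mat_adj X * X)) \<le> entry_norm k D * (entry_norm k X * entry_norm k X)"
    by (intro le2) auto
  have 2: "entry_norm k ((Y * mat_adj D) * X) \<le> (entry_norm k Y * entry_norm k D) * entry_norm k X"
    by (intro le2) auto
  have 3: "entry_norm k ((Y * mat_adj Y) * D) \<le> (entry_norm k Y * entry_norm k Y) * entry_norm k D"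
    by (intro le2) auto
  have "entry_norm k (cubic_field X - cubic_field Y) \<le> entry_norm k (D * (mat_adj X * X))
      + entry_norm k ((Y * mat_adj D) * X) + entry_norm k ((Y * mat_adj Y) * D) + entry_norm k D"
    unfolding cubic_field_diff[OF X Y] D_def[symmetric]
    by (intro order_trans[OF entry_norm_diff] add_mono order_trans[OF entry_norm_add] order_refl)
      (auto simp del: assoc_mult_mat)
  also have "\<dots> \<le> ((entry_norm k X)\<^sup>2 + entry_norm k X * entry_norm k Y + (entry_norm k Y)\<^sup>2 + 1) * entry_norm k D"
    using add_mono[OF add_mono[OF 1 2] 3] by (simp add: algebra_simps power2_eq_square)
  finally show ?thesis unfolding D_def .
qed

section \<open>Uniqueness\<close>

lemma has_real_derivative_norm_squared:
  fixes f :: "real \<Rightarrow> 'a::real_inner"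
  assumes "(f has_vector_derivative f') (at t)"
  shows "((\<lambda>s. (norm (f s))\<^sup>2) has_real_derivative 2 * inner (f t) f') (at t)"
proof -
  have "((\<lambda>s. inner (f s) (f s)) has_vector_derivative 2 * inner (f t) f') (at t)"
    using bounded_bilinear.has_vector_derivative[OF bounded_bilinear_inner assms assms]
    by (simp add: inner_commute)
  then show ?thesis
    by (simp add: has_real_derivative_iff_has_vector_derivative dot_square_norm)
qed

lemma flow_solution_entry_derivative:
  assumes "flow_solution k P0 J P" "t \<in> J" "i < k" "j < k"
  shows "((\<lambda>s. P s $$ (i, j)) has_vector_derivative (-2) *\<^sub>R cubic_field (P t) $$ (i, j)) (at t)"
proof -
  have P: "P t \<in> carrier_mat k k" using assms by (simp add: flow_solution_def)
  have "((\<lambda>s. P s $$ (i, j)) has_vector_derivative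
      ((- 2) \<cdot>\<^sub>m ((P t * mat_adj (P t) - 1\<^sub>m k) * P t)) $$ (i, j)) (at t)"
    using assms unfolding flow_solution_def has_mat_derivative_def by blast
  moreover have "cubic_field (P t) \<in> carrier_mat k k" using P by simp
  ultimately show ?thesis
    using assms(3,4) unfolding flow_rhs_eq_cubic_field[OF P] scaleR_conv_of_real by auto
qed

text \<open>The interval is arbitrary: \<open>gronwall_zero\<close> only uses bounds on the segment between \<open>0\<close> and
  the given time, so solutions may be unbounded on \<open>J\<close>.\<close>

lemma flow_solution_unique:
  assumes J: "connected J" "0 \<in> J"
    and P: "flow_solution k P0 J P" and Q: "flow_solution k P0 J Q" and t: "t \<in> J"
  shows "Q t = P t"
proof -
  define E where "E s = (\<Sum>i<k. \<Sum>j<k. (norm (Q s $$ (i, j) - P s $$ (i, j)))\<^sup>2)" for s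
  define dd where "dd s i j = (-2) *\<^sub>R (cubic_field (Q s) - cubic_field (P s)) $$ (i, j)" for s i j
  define E' where "E' s = (\<Sum>i<k. \<Sum>j<k. 2 * inner (Q s $$ (i, j) - P s $$ (i, j)) (dd s i j))" for s
  define L where "L s = (entry_norm k (Q s))\<^sup>2 + entry_norm k (Q s) * entry_norm k (P s)
    + (entry_norm k (P s))\<^sup>2 + 1" for s
  have car: "P s \<in> carrier_mat k k" "Q s \<in> carrier_mat k k" if "s \<in> J" for s
    using P Q that by (auto simp: flow_solution_def)
  have "E t = 0"
  proof (rule gronwall_zero[OF J t, of E E' "\<lambda>s. 4 * L s * (real k)\<^sup>2"])
    fix s assume s: "s \<in> J"
    have cub: "cubic_field (P s) \<in> carrier_mat k k" "cubic_field (Q s) \<in> carrier_mat k k"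
      using car[OF s] by auto
    show "(E has_real_derivative E' s) (at s)"
      unfolding E_def E'_def
    proof (intro DERIV_sum has_real_derivative_norm_squared)
      fix i j assume ij: "i \<in> {..<k}" "j \<in> {..<k}"
      show "((\<lambda>s. Q s $$ (i, j) - P s $$ (i, j)) has_vector_derivative dd s i j) (at s)"
        using has_vector_derivative_diff[OF flow_solution_entry_derivative[OF Q s, of i j]
            flow_solution_entry_derivative[OF P s, of i j]] ij cub
        by (simp add: dd_def scaleR_diff_right)
    qed
    \<comment> \<open>An entry is at most the \<open>l\<^sup>1\<close> norm of its matrix; the factor 2 is that of the equation.\<close>
    have dle: "norm (dd s i j) \<le> 2 * (L s * entry_norm k (Q s - P s))" if "i < k" "j < k" for i j
      using norm_index_le_entry_norm[OF that, of "cubic_field (Q s) - cubic_field (P s)"]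
        cubic_field_lipschitz[OF car(2)[OF s] car(1)[OF s]]
      unfolding dd_def L_def by simp
    have ent: "entry_norm k (Q s - P s) = (\<Sum>i<k. \<Sum>j<k. norm (Q s $$ (i, j) - P s $$ (i, j)))"
      "(\<Sum>i<k. \<Sum>j<k. (norm ((Q s - P s) $$ (i, j)))\<^sup>2) = E s"
      using car[OF s] by (auto simp: entry_norm_def E_def)
    have L0: "0 \<le> L s" by (simp add: L_def)
    have "\<bar>E' s\<bar> \<le> (\<Sum>i<k. \<Sum>j<k. \<bar>2 * inner (Q s $$ (i, j) - P s $$ (i, j)) (dd s i j)\<bar>)"
      unfolding E'_def by (intro order_trans[OF sum_abs] sum_mono) auto
    also have "\<dots> \<le> (\<Sum>i<k. \<Sum>j<k. norm (Q s $$ (i, j) - P s $$ (i, j)) *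
        (4 * L s * entry_norm k (Q s - P s)))"
    proof (intro sum_mono)
      fix i j assume "i \<in> {..<k}" "j \<in> {..<k}"
      then have "norm (Q s $$ (i, j) - P s $$ (i, j)) * norm (dd s i j)
          \<le> norm (Q s $$ (i, j) - P s $$ (i, j)) * (2 * (L s * entry_norm k (Q s - P s)))"
        by (intro mult_left_mono dle) auto
      then show "\<bar>2 * inner (Q s $$ (i, j) - P s $$ (i, j)) (dd s i j)\<bar> \<le>
          norm (Q s $$ (i, j) - P s $$ (i, j)) * (4 * L s * entry_norm k (Q s - P s))"
        using Cauchy_Schwarz_ineq2[of "Q s $$ (i, j) - P s $$ (i, j)" "dd s i j"]
        unfolding abs_mult abs_numeral by (simp add: algebra_simps)
    qed
    also have "\<dots> = 4 * L s * (entry_norm k (Q s - P s))\<^sup>2"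
      unfolding sum_distrib_right[symmetric] ent(1)[symmetric] by (simp add: power2_eq_square)
    also have "\<dots> \<le> 4 * L s * ((real k)\<^sup>2 * E s)"
      using entry_norm_squared_le[of k "Q s - P s"] L0 unfolding ent(2) by (intro mult_left_mono) auto
    finally show "\<bar>E' s\<bar> \<le> 4 * L s * (real k)\<^sup>2 * E s" by (simp add: mult.assoc)
    have entc: "isCont (\<lambda>s. entry_norm k (R s)) s" if "flow_solution k P0 J R" for R
      unfolding entry_norm_def
      by (intro continuous_sum continuous_norm)
        (use has_vector_derivative_continuous[OF flow_solution_entry_derivative[OF that s]] in auto)
    show "isCont (\<lambda>s. 4 * L s * (real k)\<^sup>2) s"
      unfolding L_def by (intro continuous_intros entc P Q)
  next
    show "E 0 = 0" using P Q by (simp add: E_def flow_solution_def)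
  qed (simp add: E_def sum_nonneg)
  then have "\<forall>i<k. \<forall>j<k. Q t $$ (i, j) = P t $$ (i, j)"
    unfolding E_def by (simp add: sum_nonneg_eq_0_iff sum_nonneg)
  then show ?thesis
    using car[OF t] by (intro eq_matI) auto
qed

section \<open>Equivariance under \<open>Sp k \<times> Sp k\<close>\<close>

text \<open>With \<open>X = a S b\<^sup>*\<close>, the product \<open>X X\<^sup>* X = a S (b\<^sup>* b) S\<^sup>* (a\<^sup>* a) S b\<^sup>*\<close> collapses to
  \<open>a (S S\<^sup>* S) b\<^sup>*\<close>.\<close>

lemma cubic_field_equivariant:
  assumes a: "a \<in> Sp k" and b: "b \<in> Sp k" and S: "S \<in> carrier_mat k k"
  shows "cubic_field (a * S * mat_adj b) = a * cubic_field S * mat_adj b"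
proof -
  have [simp]: "a \<in> carrier_mat k k" "b \<in> carrier_mat k k" "S \<in> carrier_mat k k"
    and ids: "mat_adj a * a = 1\<^sub>m k" "mat_adj b * b = 1\<^sub>m k"
    using a b S by (auto simp: Sp_def)
  define a' b' S' where "a' = mat_adj a" and "b' = mat_adj b" and "S' = mat_adj S"
  have [simp]: "a' \<in> carrier_mat k k" "b' \<in> carrier_mat k k" "S' \<in> carrier_mat k k"
    by (auto simp: a'_def b'_def S'_def)
  \<comment> \<open>Products are normalized to the right, so the cancellations are needed in front of a further
    factor.\<close>
  have a'a: "a' * (a * Z) = Z" if "Z \<in> carrier_mat k k" for Z
    using assoc_mult_mat[of a' k k a k Z k] that ids by (simp add: a'_def)
  have b'b: "b' * (b * Z) = Z" if "Z \<in> carrier_mat k k" for Z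
    using assoc_mult_mat[of b' k k b k Z k] that ids by (simp add: b'_def)
  have "mat_adj (a * S * b') = b * (S' * a')"
    by (simp add: mat_adj_mult[of _ k k _ k] a'_def b'_def S'_def mat_adj_adj
        assoc_mult_mat[of _ k k _ k _ k])
  then have "(a * S * b') * mat_adj (a * S * b') * (a * S * b') = a * (S * S' * S) * b'"
    by (simp add: assoc_mult_mat[of _ k k _ k _ k] a'a b'b)
  then show ?thesis
    unfolding cubic_field_def b'_def[symmetric] S'_def[symmetric]
    by (simp add: mult_minus_distrib_mat[of _ k k _ k]
        minus_mult_distrib_mat[of _ k k _ _ k] del: assoc_mult_mat)
qed

text \<open>Quaternion scalars do not commute with matrices in general, but real ones are central.\<close>

lemma smult_of_real_mult_mat:
  assumes "A \<in> carrier_mat k k" "B \<in> carrier_mat k k" "X \<in> carrier_mat k k"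
  shows "A * (of_real r \<cdot>\<^sub>m X) * B = (of_real r :: quat) \<cdot>\<^sub>m (A * X * B)"
proof -
  have 1: "A * (of_real r \<cdot>\<^sub>m X) = (of_real r :: quat) \<cdot>\<^sub>m (A * X)"
    by (rule eq_matI) (use assms in \<open>auto simp: index_mult_mat_sum[of _ k k _ k]
      scaleR_conv_of_real[symmetric] scaleR_sum_right simp del: index_mult_mat(1)\<close>)
  have 2: "(of_real r \<cdot>\<^sub>m Y) * B = (of_real r :: quat) \<cdot>\<^sub>m (Y * B)" if "Y \<in> carrier_mat k k" for Y
    by (rule eq_matI) (use assms that in \<open>auto simp: index_mult_mat_sum[of _ k k _ k]
      scaleR_conv_of_real[symmetric] scaleR_sum_right simp del: index_mult_mat(1)\<close>)
  show ?thesis using assms by (simp add: 1 2)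
qed

lemma has_mat_derivative_mult_const:
  assumes X: "has_mat_derivative X D k k t" "\<And>s. X s \<in> carrier_mat k k"
    and A: "A \<in> carrier_mat k k" and B: "B \<in> carrier_mat k k"
  shows "has_mat_derivative (\<lambda>s. A * X s * B) (A * D * B) k k t"
proof -
  have D: "D \<in> carrier_mat k k" using X by (simp add: has_mat_derivative_def)
  have entry: "(A * Y * B) $$ (i, j) = (\<Sum>l<k. (\<Sum>h<k. A $$ (i, h) * Y $$ (h, l)) * B $$ (l, j))"
    if "i < k" "j < k" "Y \<in> carrier_mat k k" for i j Y
    using that A B by (simp add: index_mult_mat_sum[of _ k k _ k] del: index_mult_mat(1) assoc_mult_mat)
  show ?thesis
    unfolding has_mat_derivative_def
  proof (intro conjI allI impI)
    show "A * D * B \<in> carrier_mat k k" using A B D by simp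
    fix i j assume ij: "i < k" "j < k"
    show "((\<lambda>s. (A * X s * B) $$ (i, j)) has_vector_derivative (A * D * B) $$ (i, j)) (at t)"
      unfolding entry[OF ij D] entry[OF ij X(2)] using X(1)
      by (intro has_vector_derivative_sum has_vector_derivative_mult_left
          has_vector_derivative_mult_right) (auto simp: has_mat_derivative_def)
  qed
qed

section \<open>The flow of the singular values\<close>

definition sv_entry :: "nat \<Rightarrow> nat \<Rightarrow> (nat \<Rightarrow> real) \<Rightarrow> nat \<Rightarrow> real" where
  "sv_entry p q c i = (if i < p then 1 else if i < p + q then c (i - p) else 0)"

lemma sv_mat_eq_mat_diag:
  "sv_mat p q r c = mat_diag (p + q + r) (\<lambda>i. of_real (sv_entry p q c i))"
  by (rule eq_matI)
    (auto simp: sv_mat_def Let_def mat_diag_def sv_entry_def dim_diag_block_mat)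

text \<open>A real diagonal matrix is self-adjoint, so its cubic field is its cube minus itself.\<close>

lemma cubic_field_real_diag:
  "cubic_field (mat_diag k (\<lambda>i. of_real (s i))) = mat_diag k (\<lambda>i. of_real (s i ^ 3 - s i))"
proof -
  have "mat_adj (mat_diag k (\<lambda>i. of_real (s i))) = mat_diag k (\<lambda>i. of_real (s i))"
    by (rule eq_matI) (auto simp: mat_diag_def)
  then show ?thesis
    unfolding cubic_field_def
    by (simp del: assoc_mult_mat) (rule eq_matI, auto simp: mat_diag_def power3_eq_cube)
qed

lemma has_mat_derivative_real_diag:
  assumes "\<And>i. i < k \<Longrightarrow> ((\<lambda>t. s t i) has_real_derivative - 2 * (s t i ^ 3 - s t i)) (at t)"
  shows "has_mat_derivative (\<lambda>t. mat_diag k (\<lambda>i. of_real (s t i)))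
    (of_real (- 2) \<cdot>\<^sub>m cubic_field (mat_diag k (\<lambda>i. of_real (s t i)))) k k t"
  unfolding has_mat_derivative_def cubic_field_real_diag
proof (intro conjI allI impI)
  fix i j assume ij: "i < k" "j < k"
  have "((\<lambda>t. of_real (s t i) :: quat) has_vector_derivative of_real (- 2 * (s t i ^ 3 - s t i))) (at t)"
    using bounded_linear.has_vector_derivative[OF bounded_linear_of_real] assms[OF ij(1)]
    unfolding has_real_derivative_iff_has_vector_derivative by blast
  then show "((\<lambda>t. mat_diag k (\<lambda>i. of_real (s t i)) $$ (i, j)) has_vector_derivative
      ((of_real (- 2) :: quat) \<cdot>\<^sub>m mat_diag k (\<lambda>i. of_real (s t i ^ 3 - s t i))) $$ (i, j)) (at t)"
    using ij by (cases "i = j") (simp_all add: mat_diag_def)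
qed (simp add: mat_diag_def)

text \<open>The square root of the logistic function: the solution of \<open>y' = 2 (y - y\<^sup>3)\<close> whose square has
  odds \<open>y\<^sup>2 / (1 - y\<^sup>2) = C\<close> at time \<open>0\<close>.\<close>

definition logistic_root :: "real \<Rightarrow> real \<Rightarrow> real" where
  "logistic_root C t = sqrt (C * exp (4 * t) / (1 + C * exp (4 * t)))"

lemma logistic_root:
  assumes "0 < C"
  shows logistic_root_pos: "0 < logistic_root C t"
    and logistic_root_squared: "(logistic_root C t)\<^sup>2 = C * exp (4 * t) / (1 + C * exp (4 * t))"
  using assms by (simp_all add: logistic_root_def add_pos_pos)

text \<open>With \<open>u = C e\<^sup>4\<^sup>t\<close> and \<open>y\<^sup>2 = u / (1 + u)\<close> one has \<open>u' = 4 u\<close>, so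
  \<open>2 y y' = (y\<^sup>2)' = 4 u / (1 + u)\<^sup>2 = 4 y\<^sup>2 (1 - y\<^sup>2)\<close>.\<close>

lemma has_real_derivative_logistic_root:
  assumes C: "0 < C"
  shows "(logistic_root C has_real_derivative
    - 2 * (logistic_root C t ^ 3 - logistic_root C t)) (at t)"
proof -
  define y where "y = logistic_root C t"
  define u where "u = C * exp (4 * t)"
  have u: "0 < u" using C by (simp add: u_def)
  have y: "0 < y" "y\<^sup>2 = u / (1 + u)" and ys: "y = sqrt (u / (1 + u))"
    using logistic_root[OF C, of t] by (auto simp: y_def u_def logistic_root_def)
  have du: "((\<lambda>t. C * exp (4 * t)) has_real_derivative 4 * u) (at t)"
    unfolding u_def by (auto intro!: derivative_eq_intros)
  have "((\<lambda>t. C * exp (4 * t) / (1 + C * exp (4 * t))) has_real_derivative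
      (4 * u * (1 + u) - u * (0 + 4 * u)) / ((1 + u) * (1 + u))) (at t)"
    using DERIV_divide[OF du DERIV_add[OF DERIV_const[of 1] du]] u unfolding u_def by simp
  also have "(4 * u * (1 + u) - u * (0 + 4 * u)) / ((1 + u) * (1 + u)) = 4 * u / (1 + u)\<^sup>2"
    by (simp add: power2_eq_square algebra_simps)
  finally have dq: "((\<lambda>t. C * exp (4 * t) / (1 + C * exp (4 * t))) has_real_derivative
      4 * u / (1 + u)\<^sup>2) (at t)" .
  have "(sqrt has_real_derivative inverse y / 2) (at (C * exp (4 * t) / (1 + C * exp (4 * t))))"
    unfolding ys u_def[symmetric] using u by (intro DERIV_real_sqrt) simp
  from DERIV_chain2[OF this dq]
  have "(logistic_root C has_real_derivative (inverse y / 2) * (4 * u / (1 + u)\<^sup>2)) (at t)"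
    unfolding logistic_root_def[abs_def] .
  moreover have "4 * u / (1 + u)\<^sup>2 = 4 * (y\<^sup>2 * (1 - y\<^sup>2))"
  proof -
    have "1 - u / (1 + u) = 1 / (1 + u)" using u by (simp add: divide_simps)
    then show ?thesis unfolding y(2) by (simp add: power2_eq_square)
  qed
  then have "(inverse y / 2) * (4 * u / (1 + u)\<^sup>2) = (inverse y * y) * (2 * (y * (1 - y\<^sup>2)))"
    by (simp add: power2_eq_square)
  then have "(inverse y / 2) * (4 * u / (1 + u)\<^sup>2) = - 2 * (y ^ 3 - y)"
    using y(1) by (simp add: power2_eq_square power3_eq_cube right_diff_distrib)
  ultimately show ?thesis by (simp add: y_def)
qed

text \<open>The curve of singular value matrices solves the equation diagonally, the entries \<open>0\<close> and \<open>1\<close>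
  being constant solutions; equivariance carries it to a solution through \<open>a S b\<^sup>*\<close>.\<close>

lemma flow_solution_svd:
  assumes a: "a \<in> Sp k" and b: "b \<in> Sp k" and k: "p + q + r = k"
    and C: "\<And>i. i < q \<Longrightarrow> 0 < C i"
  shows "flow_solution k (a * sv_mat p q r (\<lambda>i. logistic_root (C i) 0) * mat_adj b) UNIV
    (\<lambda>t. a * sv_mat p q r (\<lambda>i. logistic_root (C i) t) * mat_adj b)"
proof -
  define S where "S t = sv_mat p q r (\<lambda>i. logistic_root (C i) t)" for t
  have [simp]: "a \<in> carrier_mat k k" "b \<in> carrier_mat k k" using a b by (auto simp: Sp_def)
  have S_diag: "S t = mat_diag k (\<lambda>i. of_real (sv_entry p q (\<lambda>i. logistic_root (C i) t) i))" for t
    using k by (simp add: S_def sv_mat_eq_mat_diag)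
  have car: "S t \<in> carrier_mat k k" for t
    by (simp add: S_diag mat_diag_def)
  have deriv: "has_mat_derivative S (of_real (- 2) \<cdot>\<^sub>m cubic_field (S t)) k k t" for t
    unfolding S_diag[abs_def]
  proof (rule has_mat_derivative_real_diag)
    fix i
    show "((\<lambda>t. sv_entry p q (\<lambda>i. logistic_root (C i) t) i) has_real_derivative
        - 2 * (sv_entry p q (\<lambda>i. logistic_root (C i) t) i ^ 3
          - sv_entry p q (\<lambda>i. logistic_root (C i) t) i)) (at t)"
      using has_real_derivative_logistic_root[OF C] by (auto simp: sv_entry_def)
  qed
  have car': "a * S t * mat_adj b \<in> carrier_mat k k" for t
    using car[of t] by simp
  have "has_mat_derivative (\<lambda>t. a * S t * mat_adj b)
      ((- 2) \<cdot>\<^sub>m ((a * S t * mat_adj b * mat_adj (a * S t * mat_adj b) - 1\<^sub>m k) * (a * S t * mat_adj b)))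
      k k t" for t
  proof -
    have "has_mat_derivative (\<lambda>t. a * S t * mat_adj b)
        (a * (of_real (- 2) \<cdot>\<^sub>m cubic_field (S t)) * mat_adj b) k k t"
      by (rule has_mat_derivative_mult_const[OF deriv car]) simp_all
    moreover have "a * (of_real (- 2) \<cdot>\<^sub>m cubic_field (S t)) * mat_adj b =
        of_real (- 2) \<cdot>\<^sub>m (a * cubic_field (S t) * mat_adj b)"
      by (rule smult_of_real_mult_mat[of _ k]) (use car[of t] in simp_all)
    ultimately show ?thesis
      unfolding flow_rhs_eq_cubic_field[OF car'] cubic_field_equivariant[OF a b car] by simp
  qed
  then have "flow_solution k (a * S 0 * mat_adj b) UNIV (\<lambda>t. a * S t * mat_adj b)"
    unfolding flow_solution_def using car' by (intro conjI ballI) (rule refl)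
  then show ?thesis
    unfolding S_def .
qed

theorem lemma5p1:
  fixes n k p q r :: nat
    and T0 P0 a b :: "quat mat"
    and c C :: "nat \<Rightarrow> real"
  assumes "k < n"
    and "T0 \<in> carrier_mat (n - k) k" and "P0 \<in> carrier_mat k k"
    and "T0 @\<^sub>r P0 \<in> stiefel n k"
    and "a \<in> Sp k" and "b \<in> Sp k"
    and "p + q + r = k"
    and "\<forall>i<q. 0 < c i \<and> c i < 1"
    and "P0 = a * sv_mat p q r c * mat_adj b"
    and "\<forall>i<q. 0 < C i \<and> (c i)\<^sup>2 = C i / (1 + C i)"
  shows "\<exists>ct :: nat \<Rightarrow> real \<Rightarrow> real.
           (\<forall>i<q. \<forall>t. 0 < ct i t \<and> (ct i t)\<^sup>2 = C i * exp (4 * t) / (1 + C i * exp (4 * t))) \<and>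
           (let P = (\<lambda>t. a * sv_mat p q r (\<lambda>i. ct i t) * mat_adj b) in
              flow_solution k P0 UNIV P \<and>
              (\<forall>J Q. open J \<and> connected J \<and> 0 \<in> J \<and> flow_solution k P0 J Q \<longrightarrow>
                 (\<forall>t\<in>J. Q t = P t)))"
proof -
  let ?P = "\<lambda>t. a * sv_mat p q r (\<lambda>i. logistic_root (C i) t) * mat_adj b"
  have "logistic_root (C i) 0 = c i" if "i < q" for i
  proof -
    have "logistic_root (C i) 0 = sqrt ((c i)\<^sup>2)"
      using assms(10) that by (simp add: logistic_root_def)
    moreover have "0 \<le> c i" using assms(8) that by (simp add: less_imp_le)
    ultimately show ?thesis by simp
  qed
  then have "sv_entry p q (\<lambda>i. logistic_root (C i) 0) i = sv_entry p q c i" for i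
    by (simp add: sv_entry_def)
  then have init: "sv_mat p q r (\<lambda>i. logistic_root (C i) 0) = sv_mat p q r c"
    by (simp add: sv_mat_eq_mat_diag)
  have "\<And>i. i < q \<Longrightarrow> 0 < C i" using assms(10) by blast
  from flow_solution_svd[where C = C, OF assms(5,6,7) this]
  have sol: "flow_solution k P0 UNIV ?P"
    unfolding init assms(9)[symmetric] .
  have "Q t = ?P t" if "connected J" "0 \<in> J" "flow_solution k P0 J Q" "t \<in> J" for J Q t
  proof -
    have "flow_solution k P0 J ?P" using sol unfolding flow_solution_def by blast
    from flow_solution_unique[OF that(1,2) this that(3,4)] show ?thesis .
  qed
  then have uniq: "\<forall>J Q. open J \<and> connected J \<and> 0 \<in> J \<and> flow_solution k P0 J Q \<longrightarrow>
      (\<forall>t\<in>J. Q t = ?P t)"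
    by blast
  have "\<forall>i<q. \<forall>t. 0 < logistic_root (C i) t \<and>
      (logistic_root (C i) t)\<^sup>2 = C i * exp (4 * t) / (1 + C i * exp (4 * t))"
    using assms(10) logistic_root by blast
  with sol uniq show ?thesis
    unfolding Let_def by (intro exI[of _ "\<lambda>i. logistic_root (C i)"] conjI)
qed

end
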